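(* Let $G$ and $H$ be finitely generated groups such that $G$ is non-trivial and $H$ is infinite. Then the restricted wreath product $G \wr H$ has infinite weak cop number, i.e. $\operatorname{wCop}(G\wr H)=\infty$.
   Context: **Restricted wreath product of groups.** $G\wr H$ is the group with underlying set $\bigl(\bigoplus_{H} G\bigr)\times H$ (pairs of a finitely supported function $H\to G$, $h\mapsto g_h$, and an element of $H$) and operation $((g_h)_{h\in H},h_1)\,((g'_h)_{h\in H},h_2)=((g_h\,g'_{h_1^{-1}h})_{h\in H},\,h_1h_2)$. It is finitely generated when $G$ and $H$ are. **Graphs.** Graphs are simple and undirected. In a connected graph, $\mathsf{dist}$ denotes the path metric on vertices. For a group $K$ with generating set $S$ not containing the identity, $\operatorname{Cay}(K,S)$ is the graph with vertex set $K$ and edge set $\{\{g,gs\}: g\in K, s\in S\}$. **Weak Cops and Robbers.** Let $\Gamma$ be a connected graph and let $n,\sigma,\rho,\psi,R$ be positive integers and $v\in V(\Gamma)$. Here $n$ is the number of cops, $\sigma$ and $\rho$ are the speed and reach of the cops, $\psi$ is the speed of the robber, and $R$, $v$ are the radius and center of the area of play. It is a perfect information game. First each of the $n$ cops chooses an initial vertex; then, knowing these choices, the robber chooses an initial vertex. Then the cops and the robber move in alternating turns, starting with the cops. On the cops' turn, each cop can move to a vertex at distance at most $\sigma$ from its current position; the robber is captured during this turn if some cop moves to within distance $\rho$ of the robber. On the robber's turn, he can move to a vertex at distance at most $\psi$ from his current position, provided he has a path to that vertex containing no vertex within distance $\rho$ of any of the cops. The cops win (they "eventually protect the ball of radius $R$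 centered at $v$") if either the robber is captured at some turn or, beginning on some turn, they permanently prevent the robber from moving within distance $R$ of $v$. $\Gamma$ is $\mathrm{CopWin}(n,\sigma,\rho,\psi,R)$ if for every $v\in V(\Gamma)$, $n$ cops with speed $\sigma$ and reach $\rho$ have a strategy to eventually protect the ball of radius $R$ centered at $v$ against a robber of speed $\psi$. $\Gamma$ is $n$-weak cop win if there exist $\sigma,\rho$ such that for all $\psi,R$, $\Gamma$ is $\mathrm{CopWin}(n,\sigma,\rho,\psi,R)$. The weak cop number $\operatorname{wCop}(\Gamma)$ is the smallest $n$ such that $\Gamma$ is $n$-weak cop win, and $\operatorname{wCop}(\Gamma)=\infty$ if there is no such $n$. **Weak cop number of a group.** For a finitely generated group $K$, $\operatorname{wCop}(K)$ is defined as $\operatorname{wCop}(\operatorname{Cay}(K,S))$ for any finite generating set $S$ of $K$; it is known that this does not depend on the choice of $S$. *)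

theory Defs
  imports "HOL-Algebra.Product_Groups" "HOL-Library.Extended_Nat"
begin

section \<open>Finitely generated groups and restricted wreath products\<close>

definition finite_generating_set :: "('a, 'b) monoid_scheme \<Rightarrow> 'a set \<Rightarrow> bool" where
  "finite_generating_set K S \<longleftrightarrow> finite S \<and> S \<subseteq> carrier K \<and> generate K S = carrier K"

definition finitely_generated :: "('a, 'b) monoid_scheme \<Rightarrow> bool" where
  "finitely_generated K \<longleftrightarrow> (\<exists>S. finite_generating_set K S)"

text \<open>Elements of the direct sum are functions that are \<open>undefined\<close> outside \<open>carrier H\<close>, as
  usual for \<^const>\<open>sum_group\<close>.\<close>

definition wreath_product ::
  "('g, 'c) monoid_scheme \<Rightarrow> ('h, 'd) monoid_scheme \<Rightarrow> (('h \<Rightarrow> 'g) \<times> 'h) monoid" where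
  "wreath_product G H =
    \<lparr>carrier = carrier (sum_group (carrier H) (\<lambda>_. G)) \<times> carrier H,
     mult = (\<lambda>(f, a) (f', b).
       ((\<lambda>h\<in>carrier H. f h \<otimes>\<^bsub>G\<^esub> f' (inv\<^bsub>H\<^esub> a \<otimes>\<^bsub>H\<^esub> h)), a \<otimes>\<^bsub>H\<^esub> b)),
     one = ((\<lambda>h\<in>carrier H. \<one>\<^bsub>G\<^esub>), \<one>\<^bsub>H\<^esub>)\<rparr>"

lemma group_wreath_product:
  assumes "group G" "group H"
  shows "group (wreath_product G H)"
proof -
  interpret G: group G by fact
  interpret H: group H by fact
  let ?C = "{x \<in> carrier H \<rightarrow>\<^sub>E carrier G. finite {h \<in> carrier H. x h \<noteq> \<one>\<^bsub>G\<^esub>}}"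
  have C: "carrier (sum_group (carrier H) (\<lambda>_. G)) = ?C"
    by (simp add: carrier_sum_group)
  have shift: "finite {h \<in> carrier H. f (a \<otimes>\<^bsub>H\<^esub> h) \<noteq> \<one>\<^bsub>G\<^esub>}"
    if "finite {h \<in> carrier H. f h \<noteq> \<one>\<^bsub>G\<^esub>}" "a \<in> carrier H" for f :: "'c \<Rightarrow> 'a" and a
  proof (rule finite_subset)
    show "finite ((\<lambda>h. inv\<^bsub>H\<^esub> a \<otimes>\<^bsub>H\<^esub> h) ` {h \<in> carrier H. f h \<noteq> \<one>\<^bsub>G\<^esub>})"
      using that(1) by (rule finite_imageI)
    show "{h \<in> carrier H. f (a \<otimes>\<^bsub>H\<^esub> h) \<noteq> \<one>\<^bsub>G\<^esub>}
        \<subseteq> (\<lambda>h. inv\<^bsub>H\<^esub> a \<otimes>\<^bsub>H\<^esub> h) ` {h \<in> carrier H. f h \<noteq> \<one>\<^bsub>G\<^esub>}"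
    proof
      fix h assume h: "h \<in> {h \<in> carrier H. f (a \<otimes>\<^bsub>H\<^esub> h) \<noteq> \<one>\<^bsub>G\<^esub>}"
      then have "h = inv\<^bsub>H\<^esub> a \<otimes>\<^bsub>H\<^esub> (a \<otimes>\<^bsub>H\<^esub> h)"
        using that(2) by (simp add: H.m_assoc[symmetric])
      then show "h \<in> (\<lambda>h. inv\<^bsub>H\<^esub> a \<otimes>\<^bsub>H\<^esub> h) ` {h \<in> carrier H. f h \<noteq> \<one>\<^bsub>G\<^esub>}"
        using h that(2) by blast
    qed
  qed
  have mult_fin: "finite {h \<in> carrier H. f h \<otimes>\<^bsub>G\<^esub> f' (inv\<^bsub>H\<^esub> a \<otimes>\<^bsub>H\<^esub> h) \<noteq> \<one>\<^bsub>G\<^esub>}"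
    if "f \<in> ?C" "f' \<in> ?C" "a \<in> carrier H" for f f' a
  proof (rule finite_subset)
    show "finite ({h \<in> carrier H. f h \<noteq> \<one>\<^bsub>G\<^esub>}
        \<union> {h \<in> carrier H. f' (inv\<^bsub>H\<^esub> a \<otimes>\<^bsub>H\<^esub> h) \<noteq> \<one>\<^bsub>G\<^esub>})"
      using that shift[of f' "inv\<^bsub>H\<^esub> a"] by simp
  qed auto
  show ?thesis
  proof (rule groupI)
    fix x y
    assume "x \<in> carrier (wreath_product G H)" "y \<in> carrier (wreath_product G H)"
    then show "x \<otimes>\<^bsub>wreath_product G H\<^esub> y \<in> carrier (wreath_product G H)"
      using mult_fin
      by (auto simp: wreath_product_def C PiE_iff extensional_def cong: conj_cong)
  next
    show "\<one>\<^bsub>wreath_product G H\<^esub> \<in> carrier (wreath_product G H)"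
      by (auto simp: wreath_product_def C PiE_iff cong: conj_cong)
  next
    fix x y z
    assume "x \<in> carrier (wreath_product G H)" "y \<in> carrier (wreath_product G H)"
      "z \<in> carrier (wreath_product G H)"
    then show "x \<otimes>\<^bsub>wreath_product G H\<^esub> y \<otimes>\<^bsub>wreath_product G H\<^esub> z =
        x \<otimes>\<^bsub>wreath_product G H\<^esub> (y \<otimes>\<^bsub>wreath_product G H\<^esub> z)"
      by (auto simp: wreath_product_def C PiE_iff G.m_assoc H.m_assoc H.inv_mult_group
          intro!: restrict_ext)
  next
    fix x assume "x \<in> carrier (wreath_product G H)"
    then show "\<one>\<^bsub>wreath_product G H\<^esub> \<otimes>\<^bsub>wreath_product G H\<^esub> x = x"
      by (auto simp: wreath_product_def C PiE_iff extensional_def fun_eq_iff)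
  next
    fix x assume x: "x \<in> carrier (wreath_product G H)"
    obtain f a where xe: "x = (f, a)" and f: "f \<in> ?C" and a: "a \<in> carrier H"
      using x by (auto simp: wreath_product_def C)
    let ?f = "\<lambda>h\<in>carrier H. inv\<^bsub>G\<^esub> f (a \<otimes>\<^bsub>H\<^esub> h)"
    have fG: "f h \<in> carrier G" if "h \<in> carrier H" for h
      using f that by auto
    have "finite {h \<in> carrier H. inv\<^bsub>G\<^esub> f (a \<otimes>\<^bsub>H\<^esub> h) \<noteq> \<one>\<^bsub>G\<^esub>}"
      by (rule finite_subset[OF _ shift[of f a]]) (use f a in auto)
    then have "(?f, inv\<^bsub>H\<^esub> a) \<in> carrier (wreath_product G H)"
      using a fG by (auto simp: wreath_product_def C cong: conj_cong)
    moreover have "(?f, inv\<^bsub>H\<^esub> a) \<otimes>\<^bsub>wreath_product G H\<^esub> x = \<one>\<^bsub>wreath_product G H\<^esub>"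
      using a fG by (auto simp: xe wreath_product_def intro!: restrict_ext)
    ultimately show "\<exists>y\<in>carrier (wreath_product G H).
        y \<otimes>\<^bsub>wreath_product G H\<^esub> x = \<one>\<^bsub>wreath_product G H\<^esub>" ..
  qed
qed


section \<open>Graphs and Cayley graphs\<close>

record 'a ugraph =
  vertices :: "'a set"
  edges :: "'a set set"

definition graph_path :: "'a ugraph \<Rightarrow> 'a \<Rightarrow> 'a list \<Rightarrow> 'a \<Rightarrow> bool" where
  "graph_path \<Gamma> x p y \<longleftrightarrow> p \<noteq> [] \<and> hd p = x \<and> last p = y \<and> set p \<subseteq> vertices \<Gamma> \<and>
     successively (\<lambda>u w. {u, w} \<in> edges \<Gamma>) p"

text \<open>The value is \<open>\<infinity>\<close> if there is no path, which does not happen in a connected graph.\<close>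

definition gdist :: "'a ugraph \<Rightarrow> 'a \<Rightarrow> 'a \<Rightarrow> enat" where
  "gdist \<Gamma> x y = (INF p \<in> {p. graph_path \<Gamma> x p y}. enat (length p - 1))"

definition cayley_graph :: "('a, 'b) monoid_scheme \<Rightarrow> 'a set \<Rightarrow> 'a ugraph" where
  "cayley_graph K S =
    \<lparr>vertices = carrier K, edges = {{g, g \<otimes>\<^bsub>K\<^esub> s} | g s. g \<in> carrier K \<and> s \<in> S}\<rparr>"


section \<open>Weak Cops and Robbers\<close>

text \<open>
  The positions of the cops are given by a list of vertices. A strategy for the cops maps the list of
  positions that the robber has taken so far to the positions that the cops take next; the value at
  the empty list is their initial position. This is perfect information: the cops' own past
  positions are determined by their strategy and the robber's past positions.
\<close>

type_synonym 'a strategy = "'a list \<Rightarrow> 'a list"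

definition cop_strategy :: "'a ugraph \<Rightarrow> nat \<Rightarrow> nat \<Rightarrow> 'a strategy \<Rightarrow> bool" where
  "cop_strategy \<Gamma> n \<sigma> C \<longleftrightarrow>
    (\<forall>rs \<in> lists (vertices \<Gamma>). length (C rs) = n \<and> set (C rs) \<subseteq> vertices \<Gamma> \<and>
      (\<forall>x \<in> vertices \<Gamma>. \<forall>i<n. gdist \<Gamma> (C rs ! i) (C (rs @ [x]) ! i) \<le> enat \<sigma>))"

text \<open>
  The robber's initial vertex is \<open>r 0\<close> and \<open>r t\<close> is his position after his \<open>t\<close>-th move. The cops
  start at \<open>cops C r 0\<close>, and \<open>cops C r (Suc t)\<close> is their answer to \<open>r t\<close>.
\<close>

definition cops :: "'a strategy \<Rightarrow> (nat \<Rightarrow> 'a) \<Rightarrow> nat \<Rightarrow> 'a list" where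
  "cops C r t = C (map r [0..<t])"

definition captured :: "'a ugraph \<Rightarrow> nat \<Rightarrow> 'a strategy \<Rightarrow> (nat \<Rightarrow> 'a) \<Rightarrow> nat \<Rightarrow> bool" where
  "captured \<Gamma> \<rho> C r t \<longleftrightarrow> (\<exists>c \<in> set (cops C r (Suc t)). gdist \<Gamma> c (r t) \<le> enat \<rho>)"

text \<open>
  The speed bounds the distance between the end points of the move; the path along which the robber
  evades the cops may be longer.
\<close>

definition robber_move :: "'a ugraph \<Rightarrow> nat \<Rightarrow> nat \<Rightarrow> 'a list \<Rightarrow> 'a \<Rightarrow> 'a \<Rightarrow> bool" where
  "robber_move \<Gamma> \<rho> \<psi> cs x y \<longleftrightarrow> gdist \<Gamma> x y \<le> enat \<psi> \<and>
    (\<exists>p. graph_path \<Gamma> x p y \<and> (\<forall>u \<in> set p. \<forall>c \<in> set cs. \<not> gdist \<Gamma> c u \<le> enat \<rho>))"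

text \<open>The game ends with a capture, so the entries of \<open>r\<close> after a capture are irrelevant.\<close>

definition robber_play ::
  "'a ugraph \<Rightarrow> nat \<Rightarrow> nat \<Rightarrow> 'a strategy \<Rightarrow> (nat \<Rightarrow> 'a) \<Rightarrow> bool" where
  "robber_play \<Gamma> \<rho> \<psi> C r \<longleftrightarrow> r 0 \<in> vertices \<Gamma> \<and>
    (\<forall>t. (\<forall>k\<le>t. \<not> captured \<Gamma> \<rho> C r k) \<longrightarrow>
      robber_move \<Gamma> \<rho> \<psi> (cops C r (Suc t)) (r t) (r (Suc t)))"

definition eventually_protects ::
  "'a ugraph \<Rightarrow> nat \<Rightarrow> nat \<Rightarrow> nat \<Rightarrow> 'a \<Rightarrow> 'a strategy \<Rightarrow> bool" where
  "eventually_protects \<Gamma> \<rho> \<psi> R v C \<longleftrightarrow>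
    (\<forall>r. robber_play \<Gamma> \<rho> \<psi> C r \<longrightarrow>
      (\<exists>t. captured \<Gamma> \<rho> C r t) \<or> (\<exists>T. \<forall>t\<ge>T. \<not> gdist \<Gamma> v (r t) \<le> enat R))"

definition cop_win :: "'a ugraph \<Rightarrow> nat \<Rightarrow> nat \<Rightarrow> nat \<Rightarrow> nat \<Rightarrow> nat \<Rightarrow> bool" where
  "cop_win \<Gamma> n \<sigma> \<rho> \<psi> R \<longleftrightarrow>
    (\<forall>v \<in> vertices \<Gamma>. \<exists>C. cop_strategy \<Gamma> n \<sigma> C \<and> eventually_protects \<Gamma> \<rho> \<psi> R v C)"

definition weak_cop_win :: "'a ugraph \<Rightarrow> nat \<Rightarrow> bool" where
  "weak_cop_win \<Gamma> n \<longleftrightarrow>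
    (\<exists>\<sigma>\<ge>1. \<exists>\<rho>\<ge>1. \<forall>\<psi>\<ge>1. \<forall>R\<ge>1. cop_win \<Gamma> n \<sigma> \<rho> \<psi> R)"

text \<open>The infimum of the empty set is \<open>\<infinity>\<close>.\<close>

definition wCop :: "'a ugraph \<Rightarrow> enat" where
  "wCop \<Gamma> = Inf {enat n | n. 1 \<le> n \<and> weak_cop_win \<Gamma> n}"

text \<open>
  The common value of \<^const>\<open>wCop\<close> on the Cayley graphs of \<open>K\<close> for all finite generating sets. The
  description is unspecified if there is no finite generating set, or if the value depends on it.
\<close>

definition group_wCop :: "('a, 'b) monoid_scheme \<Rightarrow> enat" where
  "group_wCop K = (THE w. \<forall>S. finite_generating_set K S \<and> \<one>\<^bsub>K\<^esub> \<notin> S \<longrightarrow>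
     wCop (cayley_graph K S) = w)"

end

theory Submission
  imports Defs
begin

text \<open>
  To come close to the robber, a cop has to agree with him on every lamp outside a finite set around
  its own position. Fix \<open>2n\<close> lamps, two for each cop, so spread out that a cop is never near both of
  its lamps. In each turn the robber stands at \<open>\<one>\<close> with a configuration that differs from that of
  each cop on both of its lamps, so no cop can reach him in its next move. To adapt to the new
  positions of the cops, he walks, without touching his lamps, to a lamp that no cop has lit and that
  is far from all of them, lights it, and is then safe everywhere: he can rearrange the other lamps
  at will before switching this lamp off again and returning to \<open>\<one>\<close>.
\<close>

section \<open>Paths and distances\<close>

lemma graph_path_append:
  assumes "graph_path \<Gamma> x p y" "graph_path \<Gamma> y q z"
  shows "graph_path \<Gamma> x (p @ tl q) z"
proof (cases "tl q = []")
  case True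
  then show ?thesis
    using assms by (cases q) (simp_all add: graph_path_def)
next
  case False
  then obtain b q' where "q = y # b # q'"
    using assms(2) by (cases q; cases "tl q") (simp_all add: graph_path_def)
  then show ?thesis
    using assms by (simp add: graph_path_def successively_append_iff)
qed

lemma gdist_le_iff:
  "gdist \<Gamma> x y \<le> enat k \<longleftrightarrow> (\<exists>p. graph_path \<Gamma> x p y \<and> length p \<le> Suc k)"
proof
  assume "gdist \<Gamma> x y \<le> enat k"
  \<comment> \<open>Only a strict bound on an infimum yields a member of the set below the bound.
    The case without any path is covered as well, since the value is then infinite.\<close>
  then have "gdist \<Gamma> x y < enat (Suc k)"
    by (rule le_less_trans) simp
  then obtain p where "graph_path \<Gamma> x p y" "length p - 1 < Suc k"
    unfolding gdist_def INF_less_iff by auto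
  then show "\<exists>p. graph_path \<Gamma> x p y \<and> length p \<le> Suc k"
    by (intro exI[of _ p]) auto
next
  assume "\<exists>p. graph_path \<Gamma> x p y \<and> length p \<le> Suc k"
  then obtain p where "graph_path \<Gamma> x p y" "length p \<le> Suc k"
    by blast
  then show "gdist \<Gamma> x y \<le> enat k"
    unfolding gdist_def by (intro INF_lower2[of p]) auto
qed

lemma gdist_triangle:
  assumes "gdist \<Gamma> x y \<le> enat k" "gdist \<Gamma> y z \<le> enat l"
  shows "gdist \<Gamma> x z \<le> enat (k + l)"
proof -
  obtain p q where pq: "graph_path \<Gamma> x p y" "length p \<le> Suc k"
      "graph_path \<Gamma> y q z" "length q \<le> Suc l"
    using assms by (auto simp: gdist_le_iff)
  then have "length (p @ tl q) \<le> Suc (k + l)"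
    by auto
  then show ?thesis
    using graph_path_append[OF pq(1,3)] unfolding gdist_le_iff by blast
qed

text \<open>The rest of the path from \<open>u\<close> onwards is a witness. The robber uses this to
  control the intermediate vertices of a short path through its end point alone.\<close>

lemma gdist_path_end:
  assumes "graph_path \<Gamma> x p y" "u \<in> set p" "length p \<le> Suc k"
  shows "gdist \<Gamma> u y \<le> enat k"
proof -
  obtain as bs where p: "p = as @ u # bs"
    using assms(2) by (meson split_list)
  then have "graph_path \<Gamma> u (u # bs) y"
    using assms(1) by (auto simp: graph_path_def successively_append_iff)
  moreover have "length (u # bs) \<le> Suc k"
    using assms(3) p by simp
  ultimately show ?thesis
    unfolding gdist_le_iff by blast
qed

section \<open>Cayley graphs\<close>

lemma vertices_cayley_graph [simp]: "vertices (cayley_graph K S) = carrier K"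
  by (simp add: cayley_graph_def)

context group
begin

text \<open>Edges carry no direction, so traversing one backwards multiplies by the inverse of a
  generator.\<close>

lemma cayley_graph_adjacent:
  assumes "S \<subseteq> carrier G" "u \<in> carrier G" "w \<in> carrier G" "{u, w} \<in> edges (cayley_graph G S)"
  shows "\<exists>s \<in> S \<union> m_inv G ` S. w = u \<otimes> s"
proof -
  obtain g s where gs: "{u, w} = {g, g \<otimes> s}" "g \<in> carrier G" "s \<in> S"
    using assms(4) by (auto simp: cayley_graph_def)
  then consider "u = g" "w = g \<otimes> s" | "w = g" "u = g \<otimes> s"
    by (auto simp: doubleton_eq_iff)
  then show ?thesis
  proof cases
    case 1
    then show ?thesis using gs by auto
  next
    case 2
    then have "w = u \<otimes> inv s"
      using gs assms(1) by (auto simp: m_assoc subset_iff)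
    then show ?thesis using gs by auto
  qed
qed

text \<open>Left translations are automorphisms, so one finite set \<open>B\<close> serves all
  centres \<open>c\<close> at once. The induction peels off the first edge of the path, which puts a
  generator or its inverse to the left of \<open>z\<close>.\<close>

lemma cayley_graph_ball_finite:
  assumes "finite S" "S \<subseteq> carrier G"
  shows "\<exists>B. finite B \<and> B \<subseteq> carrier G \<and>
    (\<forall>c x. gdist (cayley_graph G S) c x \<le> enat k \<longrightarrow> (\<exists>z\<in>B. x = c \<otimes> z))"
proof -
  let ?T = "S \<union> m_inv G ` S"
  have "\<exists>B. finite B \<and> B \<subseteq> carrier G \<and>
    (\<forall>p c x. graph_path (cayley_graph G S) c p x \<and> length p \<le> Suc k \<longrightarrow> (\<exists>z\<in>B. x = c \<otimes> z))"
  proof (induction k)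
    case 0
    have "x = c \<otimes> \<one>" if "graph_path (cayley_graph G S) c p x" "length p \<le> Suc 0" for p c x
      using that by (cases p) (auto simp: graph_path_def)
    then show ?case
      by (intro exI[of _ "{\<one>}"]) auto
  next
    case (Suc k)
    then obtain B where B: "finite B" "B \<subseteq> carrier G"
      "\<forall>p c x. graph_path (cayley_graph G S) c p x \<and> length p \<le> Suc k \<longrightarrow> (\<exists>z\<in>B. x = c \<otimes> z)"
      by (elim exE conjE) (rule that)
    let ?B = "insert \<one> ((\<lambda>(s, z). s \<otimes> z) ` (?T \<times> B))"
    have "\<exists>z\<in>?B. x = c \<otimes> z"
      if path: "graph_path (cayley_graph G S) c p x" and len: "length p \<le> Suc (Suc k)" for p c x
    proof (cases "tl p = []")
      case True
      then have "x = c \<otimes> \<one>"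
        using path by (cases p) (auto simp: graph_path_def)
      then show ?thesis by blast
    next
      case False
      then obtain d q where p: "p = c # d # q"
        using path by (cases p; cases "tl p") (auto simp: graph_path_def)
      then have cd: "c \<in> carrier G" "d \<in> carrier G" "{c, d} \<in> edges (cayley_graph G S)"
        and "graph_path (cayley_graph G S) d (d # q) x" "length (d # q) \<le> Suc k"
        using path len by (auto simp: graph_path_def)
      then obtain z where z: "z \<in> B" "x = d \<otimes> z"
        using B(3) by blast
      obtain s where s: "s \<in> ?T" "d = c \<otimes> s"
        using cayley_graph_adjacent[OF assms(2) cd] by blast
      have "x = c \<otimes> (s \<otimes> z)"
        using z s cd B(2) assms(2) by (auto simp: m_assoc subset_iff)
      then show ?thesis
        using s z by (intro bexI[of _ "s \<otimes> z"]) auto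
    qed
    moreover have "finite ?B" "?B \<subseteq> carrier G"
      using B(1,2) assms by (auto simp: subset_iff)
    ultimately show ?case
      by (intro exI[of _ ?B] conjI allI impI) (assumption | elim conjE)+
  qed
  then show ?thesis
    unfolding gdist_le_iff by (elim ex_forward) blast
qed

text \<open>A word for \<open>y\<close> in the generators can be read off from any starting vertex,
  so its length is a bound independent of \<open>x\<close>.\<close>

lemma gdist_cayley_graph_translate:
  assumes "S \<subseteq> carrier G" "y \<in> generate G S"
  shows "\<exists>l. \<forall>x\<in>carrier G. gdist (cayley_graph G S) x (x \<otimes> y) \<le> enat l"
  using assms(2)
proof (induction y rule: generate.induct)
  case one
  have "gdist (cayley_graph G S) x (x \<otimes> \<one>) \<le> enat 0" if "x \<in> carrier G" for x
    unfolding gdist_le_iff using that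
    by (intro exI[of _ "[x]"]) (auto simp: graph_path_def)
  then show ?case by blast
next
  case (incl s)
  have "gdist (cayley_graph G S) x (x \<otimes> s) \<le> enat 1" if "x \<in> carrier G" for x
    unfolding gdist_le_iff using that incl assms(1)
    by (intro exI[of _ "[x, x \<otimes> s]"]) (auto simp: graph_path_def cayley_graph_def)
  then show ?case by blast
next
  case (inv s)
  have "gdist (cayley_graph G S) x (x \<otimes> inv s) \<le> enat 1" if x: "x \<in> carrier G" for x
  proof -
    have s: "s \<in> carrier G" using inv assms(1) by auto
    \<comment> \<open>This is the edge of the generator \<open>s\<close> that starts at the other
      end point.\<close>
    then have "{x, x \<otimes> inv s} = {x \<otimes> inv s, (x \<otimes> inv s) \<otimes> s}"
      using x by (auto simp: m_assoc)
    then have "{x, x \<otimes> inv s} \<in> edges (cayley_graph G S)"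
      unfolding cayley_graph_def using x s inv by auto
    then show ?thesis
      unfolding gdist_le_iff using x s
      by (intro exI[of _ "[x, x \<otimes> inv s]"]) (auto simp: graph_path_def)
  qed
  then show ?case by blast
next
  case (eng y z)
  then obtain l m where
    l: "\<And>x. x \<in> carrier G \<Longrightarrow> gdist (cayley_graph G S) x (x \<otimes> y) \<le> enat l" and
    m: "\<And>x. x \<in> carrier G \<Longrightarrow> gdist (cayley_graph G S) x (x \<otimes> z) \<le> enat m"
    by blast
  have yz: "y \<in> carrier G" "z \<in> carrier G"
    using eng generate_in_carrier[OF assms(1)] by auto
  have "gdist (cayley_graph G S) x (x \<otimes> (y \<otimes> z)) \<le> enat (l + m)" if "x \<in> carrier G" for x
    using gdist_triangle[OF l[OF that] m[of "x \<otimes> y"]] that yz by (simp add: m_assoc)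
  then show ?case by (intro exI ballI)
qed

lemma gdist_cayley_graph_translate_finite:
  assumes "finite_generating_set G S" "finite Y" "Y \<subseteq> carrier G"
  shows "\<exists>l. \<forall>y\<in>Y. \<forall>x\<in>carrier G. gdist (cayley_graph G S) x (x \<otimes> y) \<le> enat l"
proof -
  have "\<exists>l. \<forall>x\<in>carrier G. gdist (cayley_graph G S) x (x \<otimes> y) \<le> enat l" if "y \<in> Y" for y
  proof (rule gdist_cayley_graph_translate)
    show "S \<subseteq> carrier G" "y \<in> generate G S"
      using assms that by (auto simp: finite_generating_set_def)
  qed
  then have "\<exists>l. \<forall>y\<in>Y. \<forall>x\<in>carrier G. gdist (cayley_graph G S) x (x \<otimes> y) \<le> enat (l y)"
    by (intro bchoice) blast
  then obtain l where
    l: "\<And>x y. y \<in> Y \<Longrightarrow> x \<in> carrier G \<Longrightarrow> gdist (cayley_graph G S) x (x \<otimes> y) \<le> enat (l y)"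
    by blast
  have "gdist (cayley_graph G S) x (x \<otimes> y) \<le> enat (Max (l ` Y))"
    if "y \<in> Y" "x \<in> carrier G" for x y
    using l[OF that]
  proof (rule order_trans)
    show "enat (l y) \<le> enat (Max (l ` Y))"
      using that(1) assms(2) by simp
  qed
  then show ?thesis by blast
qed

text \<open>Greedy choice: the next point has to avoid only the finitely many elements of the
  translates of \<open>D\<close> by the earlier points.\<close>

lemma ex_separated:
  assumes "infinite (carrier G)" "finite D"
  shows "\<exists>p :: nat \<Rightarrow> 'a. \<forall>i<m. p i \<in> carrier G \<and> (\<forall>j<i. inv (p j) \<otimes> p i \<notin> D)"
proof (induction m)
  case 0
  show ?case by simp
next
  case (Suc m)
  then obtain p :: "nat \<Rightarrow> 'a" where
    p: "\<And>i. i < m \<Longrightarrow> p i \<in> carrier G" "\<And>i j. i < m \<Longrightarrow> j < i \<Longrightarrow> inv (p j) \<otimes> p i \<notin> D"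
    by blast
  have "finite ((\<lambda>(j, d). p j \<otimes> d) ` ({..<m} \<times> D))"
    using assms(2) by simp
  then obtain z where z: "z \<in> carrier G" "z \<notin> (\<lambda>(j, d). p j \<otimes> d) ` ({..<m} \<times> D)"
    using assms(1) by (meson finite_subset subsetI)
  have "inv (p j) \<otimes> z \<notin> D" if "j < m" for j
  proof
    assume "inv (p j) \<otimes> z \<in> D"
    moreover have "z = p j \<otimes> (inv (p j) \<otimes> z)"
      using z(1) p(1)[OF that] by (simp add: m_assoc[symmetric])
    ultimately show False
      using z(2) that by force
  qed
  then show ?case
    using p z(1) by (intro exI[of _ "p(m := z)"]) (auto simp: less_Suc_eq)
qed

end

section \<open>Walking and switching lamps\<close>

locale wreath = G: group G + H: group H
  for G :: "('g, 'c) monoid_scheme" and H :: "('h, 'd) monoid_scheme"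
begin

abbreviation K :: "(('h \<Rightarrow> 'g) \<times> 'h) monoid" where
  "K \<equiv> wreath_product G H"

sublocale K: group K
  by (intro group_wreath_product G.is_group H.is_group)

section \<open>Lamp configurations and elementary moves\<close>

definition lamps :: "('h \<Rightarrow> 'g) set" where
  "lamps = {f \<in> carrier H \<rightarrow>\<^sub>E carrier G. finite {h \<in> carrier H. f h \<noteq> \<one>\<^bsub>G\<^esub>}}"

lemma carrier_K: "carrier K = lamps \<times> carrier H"
  by (simp add: wreath_product_def carrier_sum_group lamps_def)

lemma mult_K:
  "(f, a) \<otimes>\<^bsub>K\<^esub> (f', b) =
    ((\<lambda>h\<in>carrier H. f h \<otimes>\<^bsub>G\<^esub> f' (inv\<^bsub>H\<^esub> a \<otimes>\<^bsub>H\<^esub> h)), a \<otimes>\<^bsub>H\<^esub> b)"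
  by (simp add: wreath_product_def)

lemma lamps_closed [simp]: "f \<in> lamps \<Longrightarrow> h \<in> carrier H \<Longrightarrow> f h \<in> carrier G"
  by (auto simp: lamps_def)

lemma lamps_undefined: "f \<in> lamps \<Longrightarrow> h \<notin> carrier H \<Longrightarrow> f h = undefined"
  by (auto simp: lamps_def)

lemma lamps_eqI:
  assumes "f \<in> lamps" "f' \<in> lamps" "\<And>h. h \<in> carrier H \<Longrightarrow> f h = f' h"
  shows "f = f'"
  using assms by (auto simp: lamps_def intro: PiE_ext)

lemma lamps_upd:
  assumes "f \<in> lamps" "q \<in> carrier H" "x \<in> carrier G"
  shows "f(q := x) \<in> lamps"
proof -
  have "finite {h \<in> carrier H. (f(q := x)) h \<noteq> \<one>\<^bsub>G\<^esub>}"
    by (rule finite_subset[of _ "insert q {h \<in> carrier H. f h \<noteq> \<one>\<^bsub>G\<^esub>}"])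
      (use assms in \<open>auto simp: lamps_def\<close>)
  moreover have "f(q := x) \<in> carrier H \<rightarrow>\<^sub>E carrier G"
    using assms by (intro PiE_I) (auto simp: lamps_undefined)
  ultimately show ?thesis
    unfolding lamps_def by blast
qed

definition lit :: "'g \<Rightarrow> 'h set \<Rightarrow> 'h \<Rightarrow> 'g" where
  "lit x A = (\<lambda>h\<in>carrier H. if h \<in> A then x else \<one>\<^bsub>G\<^esub>)"

lemma lit_in_lamps: "finite A \<Longrightarrow> x \<in> carrier G \<Longrightarrow> lit x A \<in> lamps"
  by (auto simp: lamps_def lit_def intro: finite_subset[of _ A])

definition walk_gen :: "'h \<Rightarrow> ('h \<Rightarrow> 'g) \<times> 'h" where
  "walk_gen h = (lit \<one>\<^bsub>G\<^esub> {}, h)"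

definition lamp_gen :: "'g \<Rightarrow> ('h \<Rightarrow> 'g) \<times> 'h" where
  "lamp_gen x = (lit x {\<one>\<^bsub>H\<^esub>}, \<one>\<^bsub>H\<^esub>)"

lemma mult_walk_gen:
  assumes "f \<in> lamps" "a \<in> carrier H" "h \<in> carrier H"
  shows "(f, a) \<otimes>\<^bsub>K\<^esub> walk_gen h = (f, a \<otimes>\<^bsub>H\<^esub> h)"
proof -
  have "(\<lambda>k\<in>carrier H. f k \<otimes>\<^bsub>G\<^esub> lit \<one>\<^bsub>G\<^esub> {} (inv\<^bsub>H\<^esub> a \<otimes>\<^bsub>H\<^esub> k)) = f"
  proof
    fix k
    show "(\<lambda>k\<in>carrier H. f k \<otimes>\<^bsub>G\<^esub> lit \<one>\<^bsub>G\<^esub> {} (inv\<^bsub>H\<^esub> a \<otimes>\<^bsub>H\<^esub> k)) k = f k"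
      using assms by (cases "k \<in> carrier H") (simp_all add: lit_def lamps_undefined)
  qed
  then show ?thesis
    by (simp add: walk_gen_def mult_K)
qed

lemma mult_lamp_gen:
  assumes "f \<in> lamps" "q \<in> carrier H" "x \<in> carrier G"
  shows "(f, q) \<otimes>\<^bsub>K\<^esub> lamp_gen x = (f(q := f q \<otimes>\<^bsub>G\<^esub> x), q)"
proof -
  have 1: "inv\<^bsub>H\<^esub> q \<otimes>\<^bsub>H\<^esub> h = \<one>\<^bsub>H\<^esub> \<longleftrightarrow> h = q" if "h \<in> carrier H" for h
    using assms(2) that by (metis H.inv_closed H.inv_equality H.inv_inv H.l_inv)
  have "(\<lambda>h\<in>carrier H. f h \<otimes>\<^bsub>G\<^esub> lit x {\<one>\<^bsub>H\<^esub>} (inv\<^bsub>H\<^esub> q \<otimes>\<^bsub>H\<^esub> h)) = f(q := f q \<otimes>\<^bsub>G\<^esub> x)"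
  proof
    fix h
    show "(\<lambda>h\<in>carrier H. f h \<otimes>\<^bsub>G\<^esub> lit x {\<one>\<^bsub>H\<^esub>} (inv\<^bsub>H\<^esub> q \<otimes>\<^bsub>H\<^esub> h)) h
        = (f(q := f q \<otimes>\<^bsub>G\<^esub> x)) h"
    proof (cases "h \<in> carrier H")
      case True
      then show ?thesis using assms by (simp add: lit_def 1)
    next
      case False
      then show ?thesis using assms by (auto simp: lamps_undefined)
    qed
  qed
  then show ?thesis
    using assms by (simp add: lamp_gen_def mult_K)
qed

text \<open>The inverses are put in so that every letter of a word over \<open>A\<close> or
  \<open>B\<close> is one multiplication by an element of this set.\<close>

definition gens :: "'g set \<Rightarrow> 'h set \<Rightarrow> (('h \<Rightarrow> 'g) \<times> 'h) set" where
  "gens A B = lamp_gen ` (A \<union> m_inv G ` A) \<union> walk_gen ` (B \<union> m_inv H ` B)"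

lemma gens_closed:
  assumes "A \<subseteq> carrier G" "B \<subseteq> carrier H"
  shows "gens A B \<subseteq> carrier K"
  using assms by (auto simp: gens_def lamp_gen_def walk_gen_def carrier_K lit_in_lamps subset_iff)

text \<open>\<open>L\<close> collects the configurations that a route may pass through, and
  \<open>Q\<close> says that a route exists. Keeping both abstract allows two uses: with
  \<open>Q\<close> as congruence modulo the generated subgroup this shows that
  \<open>gens A B\<close> generates, and with \<open>Q\<close> as the existence of a path out of the
  reach of the cops it moves the robber.\<close>

context
  fixes A B L and Q :: "('h \<Rightarrow> 'g) \<times> 'h \<Rightarrow> ('h \<Rightarrow> 'g) \<times> 'h \<Rightarrow> bool"
  assumes genG: "A \<subseteq> carrier G" "generate G A = carrier G"
    and genH: "B \<subseteq> carrier H" "generate H B = carrier H"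
    and L: "L \<subseteq> lamps"
    and Q_refl: "\<And>f a. f \<in> L \<Longrightarrow> a \<in> carrier H \<Longrightarrow> Q (f, a) (f, a)"
    and Q_trans: "\<And>x y z. Q x y \<Longrightarrow> Q y z \<Longrightarrow> Q x z"
    and Q_step: "\<And>f a s f' a'. f \<in> L \<Longrightarrow> a \<in> carrier H \<Longrightarrow> s \<in> gens A B \<Longrightarrow>
      (f, a) \<otimes>\<^bsub>K\<^esub> s = (f', a') \<Longrightarrow> f' \<in> L \<Longrightarrow> a' \<in> carrier H \<Longrightarrow> Q (f, a) (f', a')"
begin

lemma walk:
  assumes "f \<in> L" "a \<in> carrier H" "a' \<in> carrier H"
  shows "Q (f, a) (f, a')"
proof -
  have f: "f \<in> lamps" using assms L by auto
  have "Q (f, a) (f, a \<otimes>\<^bsub>H\<^esub> h)" if "h \<in> generate H B" "a \<in> carrier H" for h a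
    using that
  proof (induction h arbitrary: a rule: generate.induct)
    case one
    then show ?case using Q_refl assms(1) by simp
  next
    case (incl t)
    then show ?case
      using Q_step[of f a "walk_gen t"] mult_walk_gen[OF f] assms(1) genH(1)
      by (auto simp: gens_def subset_iff)
  next
    case (inv t)
    then show ?case
      using Q_step[of f a "walk_gen (inv\<^bsub>H\<^esub> t)"] mult_walk_gen[OF f] assms(1) genH(1)
      by (auto simp: gens_def subset_iff)
  next
    case (eng h h')
    then have "h \<in> carrier H" "h' \<in> carrier H"
      using genH(2) by auto
    then show ?case
      using Q_trans[OF eng.IH(1)[OF eng.prems] eng.IH(2)[of "a \<otimes>\<^bsub>H\<^esub> h"]] eng.prems
      by (simp add: H.m_assoc)
  qed
  from this[of "inv\<^bsub>H\<^esub> a \<otimes>\<^bsub>H\<^esub> a'" a] show ?thesis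
    using assms genH(2) by (simp add: H.m_assoc[symmetric])
qed

text \<open>Walk to \<open>q\<close>, spell a word over \<open>A\<close> there, and walk on to
  \<open>a'\<close>. The word passes through values at \<open>q\<close> that are not under control,
  hence the assumption for all \<open>x\<close>.\<close>

lemma switch_lamp:
  assumes f: "f \<in> lamps" and q: "q \<in> carrier H" and L_upd: "\<And>x. x \<in> carrier G \<Longrightarrow> f(q := x) \<in> L"
    and "a \<in> carrier H" "a' \<in> carrier H" "x \<in> carrier G"
  shows "Q (f, a) (f(q := x), a')"
proof -
  have step: "Q (f(q := x), q) (f(q := x \<otimes>\<^bsub>G\<^esub> s), q)"
    if "s \<in> A \<union> m_inv G ` A" "x \<in> carrier G" for s x
  proof -
    have s: "s \<in> carrier G" using that(1) genG(1) by auto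
    have "(f(q := x), q) \<otimes>\<^bsub>K\<^esub> lamp_gen s = (f(q := x \<otimes>\<^bsub>G\<^esub> s), q)"
      using mult_lamp_gen[OF lamps_upd[OF f q that(2)] q s] by simp
    then show ?thesis
      using Q_step[of "f(q := x)" q "lamp_gen s"] L_upd that s q by (auto simp: gens_def)
  qed
  have "Q (f(q := x), q) (f(q := x \<otimes>\<^bsub>G\<^esub> y), q)" if "y \<in> generate G A" "x \<in> carrier G" for x y
    using that
  proof (induction y arbitrary: x rule: generate.induct)
    case one
    then show ?case using Q_refl[OF L_upd q] by (simp only: G.r_one)
  next
    case (incl t)
    then show ?case using step by blast
  next
    case (inv t)
    then show ?case using step by blast
  next
    case (eng y y')
    then have "y \<in> carrier G" "y' \<in> carrier G"
      using genG(2) by auto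
    then show ?case
      using Q_trans[OF eng.IH(1)[OF eng.prems] eng.IH(2)[of "x \<otimes>\<^bsub>G\<^esub> y"]] eng.prems
      by (simp add: G.m_assoc)
  qed
  \<comment> \<open>This word changes the value \<open>f q\<close> into \<open>x\<close>.\<close>
  from this[of "inv\<^bsub>G\<^esub> f q \<otimes>\<^bsub>G\<^esub> x" "f q"] have "Q (f, q) (f(q := x), q)"
    using assms genG(2) by (simp add: G.m_assoc[symmetric])
  moreover have "Q (f, a) (f, q)"
    using walk[of f a q] L_upd[of "f q"] assms by simp
  moreover have "Q (f(q := x), q) (f(q := x), a')"
    using walk L_upd assms by simp
  ultimately show ?thesis
    using Q_trans by blast
qed

text \<open>The lamps of \<open>F\<close> are switched one after the other. Every configuration on
  the way agrees with \<open>f\<close> off \<open>F\<close>, which is all that membership in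
  \<open>L\<close> may depend on.\<close>

lemma switch_lamps:
  assumes "finite F" "F \<subseteq> carrier H" "f \<in> lamps" "f' \<in> lamps"
    and "\<And>h. h \<in> carrier H - F \<Longrightarrow> f' h = f h"
    and "\<And>g. g \<in> lamps \<Longrightarrow> (\<And>h. h \<in> carrier H - F \<Longrightarrow> g h = f h) \<Longrightarrow> g \<in> L"
    and "a \<in> carrier H" "a' \<in> carrier H"
  shows "Q (f, a) (f', a')"
  using assms
proof (induction F arbitrary: f a)
  case empty
  then have "f = f'"
    by (intro lamps_eqI) auto
  then show ?case
    using walk empty by auto
next
  case (insert q F)
  have q: "q \<in> carrier H" using insert.prems by auto
  have upd: "f(q := x) \<in> lamps" if "x \<in> carrier G" for x
    using lamps_upd insert.prems q that by blast
  have "Q (f, a) (f(q := f' q), a')"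
  proof (rule switch_lamp)
    show "f(q := x) \<in> L" if "x \<in> carrier G" for x
      by (rule insert.prems(5)[OF upd[OF that]]) auto
  qed (use insert.prems q in auto)
  moreover have "Q (f(q := f' q), a') (f', a')"
  proof (rule insert.IH)
    fix g assume "g \<in> lamps" "\<And>h. h \<in> carrier H - F \<Longrightarrow> g h = (f(q := f' q)) h"
    then show "g \<in> L"
      using insert.prems(5) by auto
  next
    show "f(q := f' q) \<in> lamps"
      using insert.prems(3) q by (intro upd) simp
  qed (use insert.prems in auto)
  ultimately show ?case
    using Q_trans by blast
qed

end

lemma finite_generating_set_gens:
  assumes "finite_generating_set G A" "finite_generating_set H B"
  shows "finite_generating_set K (gens A B)"
proof -
  have gen: "A \<subseteq> carrier G" "generate G A = carrier G" "B \<subseteq> carrier H" "generate H B = carrier H"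
    and fin: "finite A" "finite B"
    using assms by (auto simp: finite_generating_set_def)
  note closed = gens_closed[OF gen(1,3)]
  \<comment> \<open>Any element is reached from the identity by switching on the lamps of its
    support, and each elementary move stays in the same left coset of the generated
    subgroup.\<close>
  let ?Q = "\<lambda>x y. x \<in> carrier K \<and> y \<in> carrier K \<and> inv\<^bsub>K\<^esub> x \<otimes>\<^bsub>K\<^esub> y \<in> generate K (gens A B)"
  have "?Q (lit \<one>\<^bsub>G\<^esub> {}, \<one>\<^bsub>H\<^esub>) (f, a)" if f: "f \<in> lamps" and a: "a \<in> carrier H" for f a
  proof (rule switch_lamps[OF gen(1,2,3,4) subset_refl, where Q = ?Q])
    show "?Q (f, a) (f, a)" if "f \<in> lamps" "a \<in> carrier H" for f a
      using that by (simp add: carrier_K generate.one)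
  next
    fix x y z assume xy: "?Q x y" and yz: "?Q y z"
    have "inv\<^bsub>K\<^esub> x \<otimes>\<^bsub>K\<^esub> z = (inv\<^bsub>K\<^esub> x \<otimes>\<^bsub>K\<^esub> y) \<otimes>\<^bsub>K\<^esub> (inv\<^bsub>K\<^esub> y \<otimes>\<^bsub>K\<^esub> z)"
      using xy yz by (metis K.inv_closed K.inv_solve_left K.m_assoc K.m_closed)
    then show "?Q x z"
      using xy yz by (simp add: generate.eng)
  next
    fix f a s f' a'
    assume as: "f \<in> lamps" "a \<in> carrier H" "s \<in> gens A B" "(f, a) \<otimes>\<^bsub>K\<^esub> s = (f', a')"
      "f' \<in> lamps" "a' \<in> carrier H"
    have "(f, a) \<in> carrier K" "s \<in> carrier K"
      using as closed by (auto simp: carrier_K)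
    then have "inv\<^bsub>K\<^esub> (f, a) \<otimes>\<^bsub>K\<^esub> (f', a') = s"
      unfolding as(4)[symmetric] by (simp add: K.m_assoc[symmetric])
    then show "?Q (f, a) (f', a')"
      using as by (simp add: carrier_K generate.incl)
  next
    show "finite {h \<in> carrier H. f h \<noteq> \<one>\<^bsub>G\<^esub>}"
      using f by (simp add: lamps_def)
  next
    show "lit \<one>\<^bsub>G\<^esub> {} \<in> lamps"
      by (simp add: lit_in_lamps)
  qed (use f a in \<open>auto simp: lit_def\<close>)
  moreover have "(lit \<one>\<^bsub>G\<^esub> {}, \<one>\<^bsub>H\<^esub>) = \<one>\<^bsub>K\<^esub>"
    by (simp add: wreath_product_def lit_def)
  ultimately have "carrier K \<subseteq> generate K (gens A B)"
    by (auto simp: carrier_K)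
  then show ?thesis
    using closed fin K.generate_incl[OF closed]
    by (auto simp: finite_generating_set_def gens_def)
qed

section \<open>The strategy of the robber\<close>

text \<open>Write \<open>x\<close> as \<open>c\<close> times an element \<open>z\<close> of a finite
  ball. The lamp at \<open>p\<close> can change only if the support of \<open>z\<close> contains
  \<open>p\<close> as seen from the position of \<open>c\<close>, so \<open>E\<close> is the union
  of the supports over the ball.\<close>

lemma finite_lamp_influence:
  assumes "finite S" "S \<subseteq> carrier K"
  shows "\<exists>E. finite E \<and> (\<forall>c\<in>carrier K. \<forall>x. \<forall>p\<in>carrier H.
    gdist (cayley_graph K S) c x \<le> enat k \<longrightarrow> fst x p \<noteq> fst c p \<longrightarrow> inv\<^bsub>H\<^esub> (snd c) \<otimes>\<^bsub>H\<^esub> p \<in> E)"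
proof -
  obtain B where B: "finite B" "B \<subseteq> carrier K"
    "\<And>c x. gdist (cayley_graph K S) c x \<le> enat k \<Longrightarrow> \<exists>z\<in>B. x = c \<otimes>\<^bsub>K\<^esub> z"
    using K.cayley_graph_ball_finite[OF assms] by metis
  let ?E = "\<Union>z\<in>B. {h \<in> carrier H. fst z h \<noteq> \<one>\<^bsub>G\<^esub>}"
  have "finite ?E"
    using B(1,2) by (force simp: carrier_K lamps_def)
  moreover have "inv\<^bsub>H\<^esub> (snd c) \<otimes>\<^bsub>H\<^esub> p \<in> ?E"
    if c: "c \<in> carrier K" and p: "p \<in> carrier H"
      and dist: "gdist (cayley_graph K S) c x \<le> enat k"
      and neq: "fst x p \<noteq> fst c p" for c x p
  proof -
    obtain z where z: "z \<in> B" "x = c \<otimes>\<^bsub>K\<^esub> z"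
      using B(3)[OF dist] by blast
    have "fst x p = fst c p \<otimes>\<^bsub>G\<^esub> fst z (inv\<^bsub>H\<^esub> (snd c) \<otimes>\<^bsub>H\<^esub> p)"
      using p z(2) by (cases c; cases z) (simp add: mult_K)
    then have "fst z (inv\<^bsub>H\<^esub> (snd c) \<otimes>\<^bsub>H\<^esub> p) \<noteq> \<one>\<^bsub>G\<^esub>"
      using neq c p by (auto simp: carrier_K)
    then show ?thesis
      using z(1) c p by (auto simp: carrier_K)
  qed
  ultimately show ?thesis
    by (intro exI[of _ ?E]) blast
qed

text \<open>The robber may choose speed and radius after \<sigma> and \<rho> are known. His choice
  depends on \<open>n\<close>, \<sigma>, \<rho> and the group, but not on the strategy of the
  cops.\<close>

lemma not_cop_win:
  assumes S: "finite_generating_set K S"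
    and "finitely_generated G" "finitely_generated H"
    and nontriv: "\<not> trivial_group G" and inf: "infinite (carrier H)"
  shows "\<exists>\<psi>\<ge>1. \<exists>R\<ge>1. \<not> cop_win (cayley_graph K S) n \<sigma> \<rho> \<psi> R"
proof -
  let ?\<Gamma> = "cayley_graph K S"
  obtain A B where AB: "finite_generating_set G A" "finite_generating_set H B"
    using assms(2,3) by (auto simp: finitely_generated_def)
  then have gen: "A \<subseteq> carrier G" "generate G A = carrier G" "B \<subseteq> carrier H" "generate H B = carrier H"
    by (auto simp: finite_generating_set_def)
  obtain g0 where g0: "g0 \<in> carrier G" "g0 \<noteq> \<one>\<^bsub>G\<^esub>"
    using nontriv G.one_closed G.is_group by (auto simp: trivial_group_def)
  have "finite (gens A B)" "gens A B \<subseteq> carrier K"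
    using finite_generating_set_gens[OF AB] by (auto simp: finite_generating_set_def)
  then obtain l where l:
    "\<And>s x. s \<in> gens A B \<Longrightarrow> x \<in> carrier K \<Longrightarrow> gdist ?\<Gamma> x (x \<otimes>\<^bsub>K\<^esub> s) \<le> enat l"
    using K.gdist_cayley_graph_translate_finite[OF S] by metis
  \<comment> \<open>The radius is made of one cop move \<sigma>, the reach \<rho>, and the slack
    \<open>l\<close> for the detour in the given Cayley graph that replaces one element of
    \<open>gens A B\<close>.\<close>
  obtain E where E: "finite E"
    "\<And>c x p. c \<in> carrier K \<Longrightarrow> p \<in> carrier H \<Longrightarrow> gdist ?\<Gamma> c x \<le> enat (\<sigma> + (\<rho> + l)) \<Longrightarrow>
      fst x p \<noteq> fst c p \<Longrightarrow> inv\<^bsub>H\<^esub> (snd c) \<otimes>\<^bsub>H\<^esub> p \<in> E"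
    using finite_lamp_influence[of S "\<sigma> + (\<rho> + l)"] S
    unfolding finite_generating_set_def by metis

  \<comment> \<open>If a cop at \<open>b\<close> had both \<open>p\<close> and \<open>p'\<close> in
    \<open>b\<close> times \<open>E\<close>, the quotient of \<open>p'\<close> by \<open>p\<close>
    would be of the form \<open>inv e\<close> times \<open>e'\<close>. Adding the identity makes the
    points distinct.\<close>
  let ?D = "insert \<one>\<^bsub>H\<^esub> ((\<lambda>(e, e'). inv\<^bsub>H\<^esub> e \<otimes>\<^bsub>H\<^esub> e') ` (E \<times> E))"
  have "finite ?D"
    using E(1) by simp
  then obtain p :: "nat \<Rightarrow> 'h" where p: "\<And>i. i < 2 * n \<Longrightarrow> p i \<in> carrier H"
    and sep: "\<And>i j. i < 2 * n \<Longrightarrow> j < i \<Longrightarrow> inv\<^bsub>H\<^esub> (p j) \<otimes>\<^bsub>H\<^esub> p i \<notin> ?D"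
    using H.ex_separated[OF inf, of ?D "2 * n"] by metis
  have "p j \<noteq> p i" if "i < 2 * n" "j < i" for i j
    using sep[OF that] p[OF that(1)] by auto
  then have p_inj: "p i = p j \<longleftrightarrow> i = j" if "i < 2 * n" "j < 2 * n" for i j
    using that by (metis linorder_neqE_nat)
  define P where "P = p ` {..<2 * n}"
  have P: "finite P" "P \<subseteq> carrier H"
    using p by (auto simp: P_def)

  \<comment> \<open>Lamps \<open>2 * i\<close> and \<open>2 * i + 1\<close> belong to cop
    \<open>i\<close>. Giving a lamp the value \<open>g0\<close> exactly where its cop has the
    identity makes the two differ there, whatever the cop's value is.\<close>
  define X where "X cs = {p i | i. i < 2 * n \<and> fst (cs ! (i div 2)) (p i) = \<one>\<^bsub>G\<^esub>}"
    for cs :: "(('h \<Rightarrow> 'g) \<times> 'h) list"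
  have X: "X cs \<subseteq> P" for cs
    by (auto simp: X_def P_def)
  define pos where "pos D = (lit g0 D, \<one>\<^bsub>H\<^esub>)" for D
  have lit_X: "lit g0 (X cs) \<in> lamps" for cs
    using X P(1) g0(1) by (meson finite_subset lit_in_lamps)
  have pos_X: "pos (X cs) \<in> carrier K" for cs
    using lit_X by (simp add: pos_def carrier_K)

  \<comment> \<open>Only the lamps in \<open>P\<close> matter: the position \<open>a\<close> and all
    other lamps are free. A cop this close would have both of its lamps within its influence,
    against the separation.\<close>
  have safe: "\<not> gdist ?\<Gamma> (cs ! i) (f, a) \<le> enat (\<sigma> + (\<rho> + l))"
    if cs: "set cs \<subseteq> carrier K" "length cs = n" and "i < n"
      and agree: "\<And>h. h \<in> P \<Longrightarrow> f h = lit g0 (X cs) h"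
    for cs i f a
  proof
    assume dist: "gdist ?\<Gamma> (cs ! i) (f, a) \<le> enat (\<sigma> + (\<rho> + l))"
    obtain g b where c: "cs ! i = (g, b)" by fastforce
    have cK: "cs ! i \<in> carrier K" using cs \<open>i < n\<close> by auto
    have "inv\<^bsub>H\<^esub> b \<otimes>\<^bsub>H\<^esub> p j \<in> E" if j: "j div 2 = i" for j
    proof -
      have j2: "j < 2 * n" using j \<open>i < n\<close> by auto
      then have "p j \<in> X cs \<longleftrightarrow> g (p j) = \<one>\<^bsub>G\<^esub>"
        using c j p_inj by (fastforce simp: X_def)
      then have "lit g0 (X cs) (p j) \<noteq> g (p j)"
        using p[OF j2] g0 by (auto simp: lit_def)
      then have "f (p j) \<noteq> g (p j)"
        using agree[of "p j"] j2 by (auto simp: P_def)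
      then show ?thesis
        using E(2)[OF cK p[OF j2] dist] c by simp
    qed
    then have e: "inv\<^bsub>H\<^esub> b \<otimes>\<^bsub>H\<^esub> p (2 * i) \<in> E" "inv\<^bsub>H\<^esub> b \<otimes>\<^bsub>H\<^esub> p (2 * i + 1) \<in> E"
      by simp_all
    have "b \<in> carrier H" "p (2 * i) \<in> carrier H" "p (2 * i + 1) \<in> carrier H"
      using cK c p \<open>i < n\<close> by (auto simp: carrier_K)
    then have "inv\<^bsub>H\<^esub> (inv\<^bsub>H\<^esub> b \<otimes>\<^bsub>H\<^esub> p (2 * i)) \<otimes>\<^bsub>H\<^esub> (inv\<^bsub>H\<^esub> b \<otimes>\<^bsub>H\<^esub> p (2 * i + 1))
        = inv\<^bsub>H\<^esub> (p (2 * i)) \<otimes>\<^bsub>H\<^esub> p (2 * i + 1)"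
      by (metis H.inv_closed H.inv_inv H.inv_mult_group H.inv_solve_left H.m_assoc H.m_closed)
    then have "inv\<^bsub>H\<^esub> (p (2 * i)) \<otimes>\<^bsub>H\<^esub> p (2 * i + 1) \<in> ?D"
      using e by (intro insertI2 image_eqI
        [of _ _ "(inv\<^bsub>H\<^esub> b \<otimes>\<^bsub>H\<^esub> p (2 * i), inv\<^bsub>H\<^esub> b \<otimes>\<^bsub>H\<^esub> p (2 * i + 1))"]) simp_all
    then show False
      using sep[of "2 * i + 1" "2 * i"] \<open>i < n\<close> by simp
  qed

  \<comment> \<open>Here \<open>cs\<close> are the cops before their move and \<open>cs'\<close>
    after it. The robber passes from his answer to \<open>cs\<close> to his answer to
    \<open>cs'\<close> while the cops stand at \<open>cs'\<close>.\<close>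
  have evade: "\<exists>q. graph_path ?\<Gamma> (pos (X cs)) q (pos (X cs')) \<and>
      (\<forall>u\<in>set q. \<forall>c\<in>set cs'. \<not> gdist ?\<Gamma> c u \<le> enat \<rho>)"
    if cs: "set cs \<subseteq> carrier K" "length cs = n" and cs': "set cs' \<subseteq> carrier K" "length cs' = n"
      and move: "\<And>i. i < n \<Longrightarrow> gdist ?\<Gamma> (cs ! i) (cs' ! i) \<le> enat \<sigma>" for cs cs'
  proof -
    let ?Q = "\<lambda>x y. \<exists>q. graph_path ?\<Gamma> x q y \<and>
      (\<forall>u\<in>set q. \<forall>c\<in>set cs'. \<not> gdist ?\<Gamma> c u \<le> enat \<rho>)"
    \<comment> \<open>These configurations are safe at every position, with a margin
      \<open>l\<close> beyond the reach. The margin protects the vertices between two elementary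
      moves.\<close>
    define L where
      "L = {f \<in> lamps. \<forall>a\<in>carrier H. \<forall>c\<in>set cs'. \<not> gdist ?\<Gamma> c (f, a) \<le> enat (\<rho> + l)}"
    have L_I: "f \<in> L"
      if "f \<in> lamps" "\<And>i a. i < n \<Longrightarrow> \<not> gdist ?\<Gamma> (cs' ! i) (f, a) \<le> enat (\<rho> + l)" for f
    proof -
      have "\<not> gdist ?\<Gamma> c (f, a) \<le> enat (\<rho> + l)" if c: "c \<in> set cs'" for c a
      proof -
        obtain i where "i < n" "c = cs' ! i"
          using c cs'(2) by (auto simp: in_set_conv_nth)
        then show ?thesis
          by (simp only: \<open>\<And>i a. i < n \<Longrightarrow> \<not> gdist ?\<Gamma> (cs' ! i) (f, a) \<le> enat (\<rho> + l)\<close> not_False_eq_True)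
      qed
      with \<open>f \<in> lamps\<close> show ?thesis
        by (simp add: L_def)
    qed
    \<comment> \<open>The old lamps still protect against the new positions, because the safe radius
      includes the move of length \<sigma>.\<close>
    have L_old: "f \<in> L" if f: "f \<in> lamps" "\<And>h. h \<in> P \<Longrightarrow> f h = lit g0 (X cs) h" for f
    proof (intro L_I f notI)
      fix i a assume i: "i < n" "gdist ?\<Gamma> (cs' ! i) (f, a) \<le> enat (\<rho> + l)"
      show False
        using safe[OF cs i(1) f(2)] gdist_triangle[OF move[OF i(1)] i(2)] by contradiction
    qed
    have L_new: "f \<in> L" if f: "f \<in> lamps" "\<And>h. h \<in> P \<Longrightarrow> f h = lit g0 (X cs') h" for f
    proof (intro L_I f notI)
      fix i a assume i: "i < n" "gdist ?\<Gamma> (cs' ! i) (f, a) \<le> enat (\<rho> + l)"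
      from i(2) have "gdist ?\<Gamma> (cs' ! i) (f, a) \<le> enat (\<sigma> + (\<rho> + l))"
        by (rule order_trans) simp
      with safe[OF cs' i(1) f(2)] show False
        by contradiction
    qed

    \<comment> \<open>A lamp \<open>q0\<close> off this finite set is unlit by every cop and outside
      its influence. Lighting it therefore protects the robber whatever his other lamps are.\<close>
    let ?bad = "P \<union> (\<Union>c\<in>set cs'. {h \<in> carrier H. fst c h \<noteq> \<one>\<^bsub>G\<^esub>} \<union> (\<lambda>e. snd c \<otimes>\<^bsub>H\<^esub> e) ` E)"
    have "finite ?bad"
      using P(1) E(1) cs'(1) by (force simp: carrier_K lamps_def)
    then obtain q0 where q0: "q0 \<in> carrier H" "q0 \<notin> ?bad"
      using inf by (meson finite_subset subsetI)
    have L_lit: "f \<in> L" if f: "f \<in> lamps" "f q0 = g0" for f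
    proof -
      have "\<not> gdist ?\<Gamma> c (f, a) \<le> enat (\<rho> + l)" if c: "c \<in> set cs'" for c a
      proof
        assume "gdist ?\<Gamma> c (f, a) \<le> enat (\<rho> + l)"
        then have "gdist ?\<Gamma> c (f, a) \<le> enat (\<sigma> + (\<rho> + l))"
          by (rule order_trans) simp
        moreover have "fst c q0 = \<one>\<^bsub>G\<^esub>"
          using q0 c by auto
        ultimately have "inv\<^bsub>H\<^esub> (snd c) \<otimes>\<^bsub>H\<^esub> q0 \<in> E"
          using E(2)[of c q0 "(f, a)"] c cs'(1) q0 g0 f by auto
        moreover have "snd c \<in> carrier H"
          using c cs'(1) by (auto simp: carrier_K)
        then have "q0 = snd c \<otimes>\<^bsub>H\<^esub> (inv\<^bsub>H\<^esub> (snd c) \<otimes>\<^bsub>H\<^esub> q0)"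
          using q0(1) by (simp add: H.m_assoc[symmetric])
        ultimately show False
          using q0(2) c by blast
      qed
      then show ?thesis
        using f by (auto simp: L_def)
    qed

    have Q_refl: "?Q (f, a) (f, a)" if "f \<in> L" "a \<in> carrier H" for f a
    proof -
      have "\<not> gdist ?\<Gamma> c (f, a) \<le> enat \<rho>" if "c \<in> set cs'" for c
      proof
        assume "gdist ?\<Gamma> c (f, a) \<le> enat \<rho>"
        then have "gdist ?\<Gamma> c (f, a) \<le> enat (\<rho> + l)"
          by (rule order_trans) simp
        then show False
          using that \<open>f \<in> L\<close> \<open>a \<in> carrier H\<close> by (auto simp: L_def)
      qed
      then show ?thesis
        using that by (intro exI[of _ "[(f, a)]"]) (auto simp: graph_path_def carrier_K L_def)
    qed
    have Q_trans: "?Q x z" if xy: "?Q x y" and yz: "?Q y z" for x y z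
    proof -
      obtain q q' where "graph_path ?\<Gamma> x q y" "\<forall>u\<in>set q. \<forall>c\<in>set cs'. \<not> gdist ?\<Gamma> c u \<le> enat \<rho>"
        "graph_path ?\<Gamma> y q' z" "\<forall>u\<in>set q'. \<forall>c\<in>set cs'. \<not> gdist ?\<Gamma> c u \<le> enat \<rho>"
        using xy yz by (elim exE conjE) (rule that)
      moreover have "set (tl q') \<subseteq> set q'"
        by (cases q') auto
      ultimately show ?thesis
        using graph_path_append[of ?\<Gamma> x q y q' z] by (intro exI[of _ "q @ tl q'"]) auto
    qed
    have Q_step: "?Q (f, a) (f', a')"
      if "f \<in> L" "a \<in> carrier H" "s \<in> gens A B" "(f, a) \<otimes>\<^bsub>K\<^esub> s = (f', a')" "f' \<in> L"
        "a' \<in> carrier H" for f a s f' a'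
    proof -
      have "gdist ?\<Gamma> (f, a) (f', a') \<le> enat l"
        using l[of s "(f, a)"] that by (auto simp: carrier_K L_def)
      then obtain q where q: "graph_path ?\<Gamma> (f, a) q (f', a')" "length q \<le> Suc l"
        by (auto simp: gdist_le_iff)
      \<comment> \<open>Every vertex of the detour is within \<open>l\<close> of its end, so a cop
        in reach of it would break the margin of \<open>f'\<close>.\<close>
      have "\<not> gdist ?\<Gamma> c u \<le> enat \<rho>" if "u \<in> set q" "c \<in> set cs'" for u c
        using gdist_triangle[OF _ gdist_path_end[OF q(1) that(1) q(2)], of c \<rho>] that
          \<open>f' \<in> L\<close> \<open>a' \<in> carrier H\<close> by (auto simp: L_def)
      then show ?thesis
        using q by blast
    qed
    have switch: "?Q (pos D) (pos D')"
      if F: "finite F" "F \<subseteq> carrier H" and D: "lit g0 D \<in> lamps" "lit g0 D' \<in> lamps"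
        and off_F: "\<And>h. h \<notin> F \<Longrightarrow> h \<in> D' \<longleftrightarrow> h \<in> D"
        and in_L: "\<And>g. g \<in> lamps \<Longrightarrow> (\<And>h. h \<in> carrier H - F \<Longrightarrow> g h = lit g0 D h) \<Longrightarrow> g \<in> L"
      for F D D'
      unfolding pos_def
    proof (rule switch_lamps[where Q = ?Q and L = L and F = F, OF gen])
      show "L \<subseteq> lamps"
        by (auto simp: L_def)
      show "lit g0 D' h = lit g0 D h" if "h \<in> carrier H - F" for h
        using off_F that by (simp add: lit_def)
    qed (fact Q_refl Q_trans Q_step F D in_L H.one_closed)+
    have lit_q0: "lit g0 (insert q0 (X cs)) \<in> lamps" for cs
      using X P(1) g0(1) by (meson finite_subset finite_insert lit_in_lamps)
    have neq: "h \<noteq> q0" if "h \<in> P" for h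
      using that q0 by auto
    \<comment> \<open>Of the three legs, the first is protected by the old values on
      \<open>P\<close>, the second by \<open>q0\<close>, and the third by the new values on
      \<open>P\<close>.\<close>
    have "?Q (pos (X cs)) (pos (insert q0 (X cs)))"
    proof (rule switch[of "{q0}"])
      fix f assume "f \<in> lamps" "\<And>h. h \<in> carrier H - {q0} \<Longrightarrow> f h = lit g0 (X cs) h"
      then show "f \<in> L"
        using P neq by (intro L_old) auto
    qed (use q0 lit_X lit_q0 in auto)
    moreover have "?Q (pos (insert q0 (X cs))) (pos (insert q0 (X cs')))"
    proof (rule switch[of P])
      fix f assume "f \<in> lamps" "\<And>h. h \<in> carrier H - P \<Longrightarrow> f h = lit g0 (insert q0 (X cs)) h"
      then show "f \<in> L"
        using q0 by (intro L_lit) (auto simp: lit_def)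
    qed (use P X lit_q0 in auto)
    moreover have "?Q (pos (insert q0 (X cs'))) (pos (X cs'))"
    proof (rule switch[of "{q0}"])
      fix f
      assume "f \<in> lamps" "\<And>h. h \<in> carrier H - {q0} \<Longrightarrow> f h = lit g0 (insert q0 (X cs')) h"
      then show "f \<in> L"
        using P neq by (intro L_new) (auto simp: lit_def)
    qed (use q0 lit_X lit_q0 in auto)
    ultimately show ?thesis
      by (rule Q_trans[OF Q_trans])
  qed

  let ?V = "pos ` Pow P"
  \<comment> \<open>The speed limits only the distance between the end points of a move, and these
    lie in the finite set \<open>?V\<close>. Hence \<open>m\<close> does not depend on
    \<open>q0\<close>, which may be arbitrarily far away. The elements of \<open>?V\<close> bound
    the distance to the identity, and the quotients bound the moves.\<close>
  let ?Y = "?V \<union> (\<lambda>(x, y). inv\<^bsub>K\<^esub> x \<otimes>\<^bsub>K\<^esub> y) ` (?V \<times> ?V)"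
  have V: "?V \<subseteq> carrier K"
    using P g0(1) by (auto simp: pos_def carrier_K intro!: lit_in_lamps intro: finite_subset)
  have "?Y \<subseteq> carrier K"
    using V by (intro Un_least V image_subsetI) (auto simp del: split_paired_All)
  moreover have "finite ?Y"
    using P(1) by simp
  ultimately obtain m where m: "\<And>x y. y \<in> ?Y \<Longrightarrow> x \<in> carrier K \<Longrightarrow> gdist ?\<Gamma> x (x \<otimes>\<^bsub>K\<^esub> y) \<le> enat m"
    using K.gdist_cayley_graph_translate_finite[OF S] by metis
  \<comment> \<open>Speed and radius have to be positive, so \<open>Suc m\<close> replaces
    \<open>m\<close>.\<close>
  have mono: "gdist ?\<Gamma> x y \<le> enat (Suc m)" if "gdist ?\<Gamma> x y \<le> enat m" for x y
    using that by (rule order_trans) simp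
  have pos_V: "pos (X cs) \<in> ?V" for cs
    using X by auto
  have m_one: "gdist ?\<Gamma> \<one>\<^bsub>K\<^esub> (pos (X cs)) \<le> enat (Suc m)" for cs
    using m[of "pos (X cs)" "\<one>\<^bsub>K\<^esub>"] pos_V pos_X mono by simp
  have m_pos: "gdist ?\<Gamma> (pos (X cs)) (pos (X cs')) \<le> enat (Suc m)" for cs cs'
  proof -
    have "inv\<^bsub>K\<^esub> (pos (X cs)) \<otimes>\<^bsub>K\<^esub> pos (X cs') \<in> ?Y"
      using pos_V by force
    from m[OF this pos_X[of cs]] show ?thesis
      using pos_X mono by (simp add: K.m_assoc[symmetric])
  qed

  have "\<not> eventually_protects ?\<Gamma> \<rho> (Suc m) (Suc m) \<one>\<^bsub>K\<^esub> C" if C: "cop_strategy ?\<Gamma> n \<sigma> C" for C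
  proof -
    \<comment> \<open>Robber and cops answer each other, so the play is defined by recursion on the
      whole history: \<open>rs t\<close> lists the first \<open>t\<close> positions of the robber,
      and \<open>r t\<close> answers the cops at \<open>C (rs t)\<close>.\<close>
    define rs where "rs = rec_nat [] (\<lambda>t xs. xs @ [pos (X (C xs))])"
    define r where "r t = pos (X (C (rs t)))" for t
    have rs_Suc: "rs (Suc t) = rs t @ [r t]" for t
      by (simp add: rs_def r_def)
    have "map r [0..<t] = rs t" for t
      by (induction t) (auto simp: rs_Suc, simp add: rs_def)
    then have cops_r: "cops C r t = C (rs t)" for t
      by (simp add: cops_def)
    have rK: "r t \<in> carrier K" for t
      using pos_X by (simp add: r_def)
    have "rs t \<in> lists (carrier K)" for t
      by (induction t) (auto simp: rs_Suc rK, simp add: rs_def)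
    then have cs: "set (C (rs t)) \<subseteq> carrier K" "length (C (rs t)) = n"
      and move: "\<And>i. i < n \<Longrightarrow> gdist ?\<Gamma> (C (rs t) ! i) (C (rs (Suc t)) ! i) \<le> enat \<sigma>" for t
      using C rK by (auto simp: cop_strategy_def rs_Suc)
    have "\<not> captured ?\<Gamma> \<rho> C r t" for t
    proof
      assume "captured ?\<Gamma> \<rho> C r t"
      then obtain i where i: "i < n" "gdist ?\<Gamma> (C (rs (Suc t)) ! i) (r t) \<le> enat \<rho>"
        using cs(2)[of "Suc t"] by (auto simp: captured_def cops_r in_set_conv_nth)
      \<comment> \<open>Capture is tested after the cops' reply to \<open>r t\<close>, whereas
        \<open>r t\<close> was chosen against their positions one move earlier.\<close>
      have "gdist ?\<Gamma> (C (rs t) ! i) (r t) \<le> enat (\<sigma> + \<rho>)"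
        using gdist_triangle[OF move[OF i(1)] i(2)] .
      then have "gdist ?\<Gamma> (C (rs t) ! i) (r t) \<le> enat (\<sigma> + (\<rho> + l))"
        by (rule order_trans) simp
      then show False
        using safe[OF cs i(1)] by (simp add: r_def pos_def)
    qed
    moreover have "robber_move ?\<Gamma> \<rho> (Suc m) (cops C r (Suc t)) (r t) (r (Suc t))" for t
      using evade[OF cs cs move, of t] m_pos
      by (simp add: robber_move_def cops_r r_def[symmetric]) (simp add: r_def)
    then have "robber_play ?\<Gamma> \<rho> (Suc m) C r"
      using rK by (simp add: robber_play_def)
    moreover have "gdist ?\<Gamma> \<one>\<^bsub>K\<^esub> (r t) \<le> enat (Suc m)" for t
      using m_one by (simp add: r_def)
    ultimately show ?thesis
      unfolding eventually_protects_def by blast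
  qed
  then have "\<not> cop_win ?\<Gamma> n \<sigma> \<rho> (Suc m) (Suc m)"
    using K.one_closed by (auto simp: cop_win_def)
  then show ?thesis
    by (intro exI[of _ "Suc m"] conjI) auto
qed

end

section \<open>Passage from Cayley graphs to the group\<close>

theorem theorem1p5:
  fixes G :: "('g, 'c) monoid_scheme" and H :: "('h, 'd) monoid_scheme"
  assumes "group G" and "group H"
    and "finitely_generated G" and "finitely_generated H"
    and "\<not> trivial_group G" and "infinite (carrier H)"
  shows "group_wCop (wreath_product G H) = \<infinity>"
proof -
  interpret wreath G H
    using assms by (simp add: wreath_def)
  have wCop: "wCop (cayley_graph K S) = \<infinity>" if "finite_generating_set K S" for S
  proof -
    have "\<not> weak_cop_win (cayley_graph K S) n" for n
      using not_cop_win[OF that assms(3-6)] unfolding weak_cop_win_def by blast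
    then show ?thesis
      by (simp add: wCop_def top_enat_def)
  qed
  obtain A B where "finite_generating_set G A" "finite_generating_set H B"
    using assms by (auto simp: finitely_generated_def)
  then have gens: "finite_generating_set K (gens A B)"
    by (rule finite_generating_set_gens)
  \<comment> \<open>The description in \<open>group_wCop\<close> needs at least one generating set
    without the identity; otherwise every \<open>w\<close> would satisfy it vacuously.
    \<open>gens A B\<close> contains the identity if \<open>A\<close> or \<open>B\<close>
    does.\<close>
  let ?S = "gens A B - {\<one>\<^bsub>K\<^esub>}"
  have closed: "gens A B \<subseteq> carrier K"
    using gens by (simp add: finite_generating_set_def)
  have "generate K (gens A B) \<subseteq> generate K ?S"
  proof (rule K.generate_subgroup_incl)
    show "gens A B \<subseteq> generate K ?S"
      using generate.incl[of _ ?S K] generate.one[of K ?S] by blast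
    show "subgroup (generate K ?S) K"
      using closed by (intro K.generate_is_subgroup) auto
  qed
  then have S: "finite_generating_set K ?S"
    using gens K.generate_incl[of ?S] by (auto simp: finite_generating_set_def)
  show ?thesis
    unfolding group_wCop_def
  proof (rule the_equality)
    show "\<forall>S. finite_generating_set K S \<and> \<one>\<^bsub>K\<^esub> \<notin> S \<longrightarrow> wCop (cayley_graph K S) = \<infinity>"
      using wCop by blast
  next
    fix w assume "\<forall>S. finite_generating_set K S \<and> \<one>\<^bsub>K\<^esub> \<notin> S \<longrightarrow> wCop (cayley_graph K S) = w"
    then show "w = \<infinity>"
      using S wCop[OF S] by auto
  qed
qed

end
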